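(* Let $r,m\in\mathbb{Z}$ with $0\leqslant r\leqslant m$, and let $s_m(r)=\sum_{i=0}^r\binom{m}{i}$. (a) If $b_i=2i(r+1-i)$ and $a_i=m-2r+3i$ for $0\leqslant i\leqslant r$, then $$Q:=\frac{(r+1)\binom{m}{r+1}}{s_m(r)}=a_0+\mathcal{T}_1,$$ where $\mathcal{T}_1=\mathop{\mathcal{K}}_{i=1}^{r}\frac{b_i}{a_i}$ is the generalized continued fraction with partial numerators $b_1,\dots,b_r$ and partial denominators $a_1,\dots,a_r$. (b) Let $R_j:=2^j\,j!\sum_{k=0}^{r-j}\binom{r-k}{j}\binom{m}{k}$. If $1\leqslant j\leqslant r$, then the $j$th tail $\mathcal{T}_j=\mathop{\mathcal{K}}_{i=j}^{r}\frac{b_i}{a_i}$ satisfies $\mathcal{T}_j=R_j/R_{j-1}>0$, and $b_jR_{j-1}-a_jR_j=R_{j+1}$. Also, $(m-r)\binom{m}{r}-a_0R_0=R_1$.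
   Context: The generalized continued fraction (Kettenbruch) notation is $$\mathcal{T}_j=\mathop{\mathcal{K}}_{i=j}^{r}\frac{b_i}{a_i}=\cfrac{b_j}{a_j+\cfrac{b_{j+1}}{a_{j+1}+\cfrac{\ddots}{\,a_{r-1}+\cfrac{b_r}{a_r}}}},$$ that is, $\mathcal{T}_{r+1}=0$ and $\mathcal{T}_j=\frac{b_j}{a_j+\mathcal{T}_{j+1}}$ for $1\leqslant j\leqslant r$. The $\mathcal{T}_j$ with $1\leqslant j\leqslant r$ are called the tails; the claim includes that they are well defined (no denominator vanishes). When $r=0$, $\mathcal{T}_1=0$. Empty sums are $0$ (so $R_{r+1}=0$), and $\binom{m}{i}=0$ for an integer $i>m$. *)

theory Defs
  imports Complex_Main
begin

function kettenbruch :: "(nat \<Rightarrow> 'a) \<Rightarrow> (nat \<Rightarrow> 'a) \<Rightarrow> nat \<Rightarrow> nat \<Rightarrow> 'a::field" where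
  "kettenbruch b a j r = (if r < j then 0 else b j / (a j + kettenbruch b a (j + 1) r))"
  by pat_completeness auto
termination
  by (relation "measure (\<lambda>(b, a, j, r). r + 1 - j)") auto

declare kettenbruch.simps [simp del]

text \<open>As \<open>x / 0 = 0\<close> in HOL, that no denominator of the continued fraction vanishes has to be
  said separately.\<close>

definition kettenbruch_defined :: "(nat \<Rightarrow> 'a::field) \<Rightarrow> (nat \<Rightarrow> 'a) \<Rightarrow> nat \<Rightarrow> nat \<Rightarrow> bool" where
  "kettenbruch_defined b a j r \<longleftrightarrow> (\<forall>i\<in>{j..r}. a i + kettenbruch b a (i + 1) r \<noteq> 0)"

definition binom_sum :: "nat \<Rightarrow> nat \<Rightarrow> nat" where
  "binom_sum m r = (\<Sum>i=0..r. m choose i)"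

definition partial_num :: "nat \<Rightarrow> nat \<Rightarrow> real" where
  "partial_num r i = 2 * real i * (real r + 1 - real i)"

definition partial_den :: "nat \<Rightarrow> nat \<Rightarrow> nat \<Rightarrow> real" where
  "partial_den m r i = real m - 2 * real r + 3 * real i"

text \<open>The range \<open>k < r + 1 - j\<close> is \<open>0 \<le> k \<le> r - j\<close> for \<open>j \<le> r\<close>, and it is empty for \<open>j = r + 1\<close>,
  where the truncated upper bound \<open>r - j\<close> would leave \<open>k = 0\<close>.\<close>

definition R_sum :: "nat \<Rightarrow> nat \<Rightarrow> nat \<Rightarrow> real" where
  "R_sum m r j = 2 ^ j * fact j * (\<Sum>k<r + 1 - j. real ((r - k) choose j) * real (m choose k))"

end

theory Submission
  imports Defs
begin

text \<open>
  The continued fraction is evaluated by exhibiting a solution of its three-term recurrence. If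
  \<open>b\<^sub>i R\<^sub>i\<^sub>-\<^sub>1 = a\<^sub>i R\<^sub>i + R\<^sub>i\<^sub>+\<^sub>1\<close> holds along the fraction and \<open>R\<close> vanishes one step past its end, then
  dividing by \<open>R\<^sub>i\<close> shows by downward induction that the tails are the quotients \<open>R\<^sub>j / R\<^sub>j\<^sub>-\<^sub>1\<close> and that
  the denominators are \<open>b\<^sub>i R\<^sub>i\<^sub>-\<^sub>1 / R\<^sub>i\<close>, nonzero as soon as all \<open>b\<^sub>i\<close> and \<open>R\<^sub>i\<close> are (\<open>kettenbruch_eq_quotient\<close>,
  \<open>kettenbruch_defined_of_recurrence\<close>). Here the numbers \<open>R\<^sub>0, \<dots>, R\<^sub>r\<close> are positive because their
  summand at \<open>k = 0\<close> is, \<open>R\<^sub>r\<^sub>+\<^sub>1\<close> is an empty sum, and \<open>b\<^sub>i > 0\<close> for \<open>1 \<le> i \<le> r\<close>.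

  It remains to verify the recurrence. Up to the factor \<open>2\<^sup>j j!\<close>, the number \<open>R\<^sub>j\<close> is the sum of
  \<open>(m choose k) (r - k choose j)\<close> over \<open>k \<le> r\<close>. Rewriting \<open>n choose (j + 1)\<close> in
  terms of \<open>n choose j\<close>, and \<open>n choose j\<close> in terms of \<open>n choose (j - 1)\<close>, by absorption turns the recurrence into a sum that
  telescopes, with \<open>k (m choose k) (r + 1 - k choose j)\<close> as the telescoping quantity
  (\<open>sum_binomial_telescope\<close>). Its boundary term \<open>(r + 1) (m choose (r + 1)) (0 choose j)\<close> vanishes
  for \<open>j > 0\<close>; for \<open>j = 0\<close> it is \<open>(m - r) (m choose r)\<close>, the numerator of \<open>Q\<close>. So the case \<open>j = 0\<close>,
  divided by \<open>R\<^sub>0 = s\<^sub>m(r)\<close>, is the evaluation of \<open>Q\<close>.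
\<close>

section \<open>Continued fractions from three-term recurrences\<close>

text \<open>The induction can start at \<open>j = r + 1\<close>, where the empty fraction \<open>0\<close> matches \<open>R (r + 1) = 0\<close>.\<close>

lemma kettenbruch_eq_quotient:
  fixes R a b :: "nat \<Rightarrow> 'a::field"
  assumes rec: "\<And>i. 1 \<le> i \<Longrightarrow> i \<le> r \<Longrightarrow> b i * R (i - 1) = a i * R i + R (i + 1)"
    and nz: "\<And>i. i \<le> r \<Longrightarrow> R i \<noteq> 0"
    and b: "\<And>i. 1 \<le> i \<Longrightarrow> i \<le> r \<Longrightarrow> b i \<noteq> 0"
    and last: "R (r + 1) = 0"
    and j: "1 \<le> j" "j \<le> r + 1"
  shows "kettenbruch b a j r = R j / R (j - 1)"
  using j(2,1)
proof (induction j rule: inc_induct)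
  case base
  then show ?case
    using last by (simp add: kettenbruch.simps)
next
  case (step n)
  then have n: "1 \<le> n" "n \<le> r" and IH: "kettenbruch b a (n + 1) r = R (n + 1) / R n"
    by auto
  have "a n + R (n + 1) / R n = b n * R (n - 1) / R n"
    using rec[OF n] nz[of n] n by (simp add: field_simps)
  then have "kettenbruch b a n r = b n / (b n * R (n - 1) / R n)"
    using n IH by (simp add: kettenbruch.simps[of b a n r])
  also have "\<dots> = R n / R (n - 1)"
    using b[OF n] by simp
  finally show ?case .
qed

lemma kettenbruch_defined_of_recurrence:
  fixes R a b :: "nat \<Rightarrow> 'a::field"
  assumes rec: "\<And>i. 1 \<le> i \<Longrightarrow> i \<le> r \<Longrightarrow> b i * R (i - 1) = a i * R i + R (i + 1)"
    and nz: "\<And>i. i \<le> r \<Longrightarrow> R i \<noteq> 0"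
    and b: "\<And>i. 1 \<le> i \<Longrightarrow> i \<le> r \<Longrightarrow> b i \<noteq> 0"
    and last: "R (r + 1) = 0"
  shows "kettenbruch_defined b a 1 r"
  unfolding kettenbruch_defined_def
proof
  fix i assume "i \<in> {1..r}"
  then have i: "1 \<le> i" "i \<le> r"
    by auto
  have "kettenbruch b a (i + 1) r = R (i + 1) / R i"
    using kettenbruch_eq_quotient[of r b R a "i + 1", OF rec nz b last] i by simp
  then have "a i + kettenbruch b a (i + 1) r = b i * R (i - 1) / R i"
    using rec[OF i] nz[of i] i by (simp add: field_simps)
  then show "a i + kettenbruch b a (i + 1) r \<noteq> 0"
    using b[OF i] nz[of i] nz[of "i - 1"] i by simp
qed

section \<open>A telescoping binomial sum\<close>

lemma binomial_absorb_real:
  "(real k + 1) * real (n choose (k + 1)) = (real n - real k) * real (n choose k)"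
proof (cases "k \<le> n")
  case True
  have "Suc k * (n choose Suc k) = (n - k) * (n choose k)"
    by (simp only: binomial_absorb_comp binomial_absorption)
  then have "real (Suc k * (n choose Suc k)) = real ((n - k) * (n choose k))"
    by simp
  then show ?thesis
    using True by (simp add: of_nat_diff algebra_simps)
qed (simp add: binomial_eq_0)

text \<open>By absorption, \<open>(m - k) (m choose k) f (r - k)\<close> is the value at \<open>k + 1\<close> of
  \<open>k (m choose k) f (r + 1 - k)\<close>, so consecutive summands cancel.\<close>

lemma sum_binomial_telescope:
  fixes f :: "nat \<Rightarrow> real"
  shows "(\<Sum>k\<le>r. real (m choose k) * ((real m - real k) * f (r - k) - real k * f (r + 1 - k)))
    = (real r + 1) * real (m choose (r + 1)) * f 0"
proof -
  define G where "G k = real k * real (m choose k) * f (r + 1 - k)" for k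
  have G_Suc: "G (Suc k) = (real m - real k) * real (m choose k) * f (r - k)" for k
    using binomial_absorb_real[of k m] by (simp add: G_def add.commute)
  have "(\<Sum>k\<le>r. real (m choose k) * ((real m - real k) * f (r - k) - real k * f (r + 1 - k)))
      = (\<Sum>k\<le>r. G (Suc k) - G k)"
    unfolding G_Suc by (intro sum.cong) (simp_all add: G_def algebra_simps)
  also have "\<dots> = G (Suc r) - G 0"
    using sum_lessThan_telescope[of G "Suc r"] by (simp add: lessThan_Suc_atMost)
  finally show ?thesis
    by (simp add: G_def algebra_simps)
qed

section \<open>The numbers \<open>R\<^sub>j\<close>\<close>

text \<open>Letting \<open>k\<close> run up to \<open>r\<close> for every \<open>j\<close> adds only zero summands and makes the
  sums for different \<open>j\<close> comparable term by term.\<close>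

lemma R_sum_atMost:
  "R_sum m r j = 2 ^ j * fact j * (\<Sum>k\<le>r. real ((r - k) choose j) * real (m choose k))"
proof -
  have "(\<Sum>k<r + 1 - j. real ((r - k) choose j) * real (m choose k))
      = (\<Sum>k\<le>r. real ((r - k) choose j) * real (m choose k))"
    by (rule sum.mono_neutral_left) auto
  then show ?thesis
    by (simp add: R_sum_def)
qed

lemma R_sum_pos:
  assumes "j \<le> r"
  shows "R_sum m r j > 0"
proof -
  have "(\<Sum>k\<le>r. real ((r - k) choose j) * real (m choose k)) > 0"
    using assms by (intro sum_pos2[of _ 0]) auto
  then show ?thesis
    by (simp add: R_sum_atMost)
qed

lemma R_sum_beyond: "R_sum m r (r + 1) = 0"
  by (simp add: R_sum_def)

lemma R_sum_0: "R_sum m r 0 = real (binom_sum m r)"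
  by (simp add: R_sum_atMost binom_sum_def atMost_atLeast0)

text \<open>Absorption puts \<open>R\<^sub>j\<^sub>+\<^sub>1\<close> over the same binomial coefficients as \<open>R\<^sub>j\<close>.\<close>

lemma R_sum_Suc:
  "R_sum m r (j + 1) = 2 ^ j * fact j *
    (\<Sum>k\<le>r. 2 * (real r - real k - real j) * real ((r - k) choose j) * real (m choose k))"
proof -
  have "2 * (real j + 1) * (\<Sum>k\<le>r. real ((r - k) choose (j + 1)) * real (m choose k))
      = (\<Sum>k\<le>r. 2 * (real r - real k - real j) * real ((r - k) choose j) * real (m choose k))"
    unfolding sum_distrib_left
  proof (rule sum.cong)
    fix k assume "k \<in> {..r}"
    then have "(real j + 1) * real ((r - k) choose (j + 1))
        = (real r - real k - real j) * real ((r - k) choose j)"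
      using binomial_absorb_real[of j "r - k"] by (simp add: of_nat_diff)
    then have "2 * ((real j + 1) * real ((r - k) choose (j + 1))) * real (m choose k)
        = 2 * ((real r - real k - real j) * real ((r - k) choose j)) * real (m choose k)"
      by (simp only:)
    then show "2 * (real j + 1) * (real ((r - k) choose (j + 1)) * real (m choose k))
        = 2 * (real r - real k - real j) * real ((r - k) choose j) * real (m choose k)"
      by (simp only: mult.assoc)
  qed simp
  moreover have "R_sum m r (j + 1) = 2 ^ j * fact j *
      (2 * (real j + 1) * (\<Sum>k\<le>r. real ((r - k) choose (j + 1)) * real (m choose k)))"
    by (simp add: R_sum_atMost algebra_simps)
  ultimately show ?thesis
    by simp
qed

text \<open>For \<open>j = 0\<close> the telescoping sum is taken with the constant function \<open>f = 1\<close>, the only case in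
  which the boundary term survives.\<close>

lemma R_sum_recurrence_0:
  "(real r + 1) * real (m choose (r + 1)) = partial_den m r 0 * R_sum m r 0 + R_sum m r 1"
proof -
  have "partial_den m r 0 * R_sum m r 0 + R_sum m r 1
      = (\<Sum>k\<le>r. real (m choose k) * ((real m - real k) * 1 - real k * 1))"
    using R_sum_Suc[of m r 0]
    by (simp add: R_sum_atMost[of m r 0] partial_den_def sum_distrib_left
        flip: sum.distrib, intro sum.cong, simp_all add: algebra_simps)
  also have "\<dots> = (real r + 1) * real (m choose (r + 1))"
    using sum_binomial_telescope[of m "\<lambda>_. 1" r] by simp
  finally show ?thesis
    by simp
qed

text \<open>With \<open>n = r - k\<close>, absorption in the form
  \<open>j (n choose j) = (n - j + 1) (n choose (j - 1))\<close> makes the coefficient of \<open>(m choose k)\<close> in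
  \<open>a\<^sub>j R\<^sub>j + R\<^sub>j\<^sub>+\<^sub>1 - b\<^sub>j R\<^sub>j\<^sub>-\<^sub>1\<close> equal, up to the common factor \<open>2\<^sup>j j!\<close>, to
  \<open>(m - 2 k) (n choose j) - k (n choose (j - 1))\<close>. By Pascal's rule this is
  \<open>(m - k) (n choose j) - k (n + 1 choose j)\<close>, the summand of the telescoping sum.\<close>

lemma R_sum_recurrence:
  assumes "1 \<le> j"
  shows "partial_num r j * R_sum m r (j - 1) = partial_den m r j * R_sum m r j + R_sum m r (j + 1)"
proof -
  obtain i where j: "j = i + 1"
    using assms by (metis le_add_diff_inverse2)
  let ?c = "2 ^ j * fact j :: real"
  let ?A = "\<lambda>k. (real m - 2 * real r + 3 * real j) * (real ((r - k) choose j) * real (m choose k))"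
  let ?B = "\<lambda>k. 2 * (real r - real k - real j) * real ((r - k) choose j) * real (m choose k)"
  let ?C = "\<lambda>k. (real r + 1 - real j) * (real ((r - k) choose i) * real (m choose k))"
  let ?f = "\<lambda>n. real (n choose j)"
  have summand: "?A k + ?B k - ?C k
      = real (m choose k) * ((real m - real k) * ?f (r - k) - real k * ?f (r + 1 - k))"
    if "k \<le> r" for k
  proof -
    define p q where "p = real ((r - k) choose i)" and "q = real ((r - k) choose j)"
    have absorb: "(real i + 1) * q = (real r - real k - real i) * p"
      using binomial_absorb_real[of i "r - k"] that by (simp add: p_def q_def j of_nat_diff)
    have pascal: "?f (r + 1 - k) = p + q"
      using that by (simp add: p_def q_def j Suc_diff_le)
    have "(real m - 2 * real r + 3 * real j) * q + 2 * (real r - real k - real j) * q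
        - (real r + 1 - real j) * p = (real m - real k) * q - real k * (p + q)"
      using absorb by (simp add: j algebra_simps)
    then have "real (m choose k) * ((real m - 2 * real r + 3 * real j) * q
        + 2 * (real r - real k - real j) * q - (real r + 1 - real j) * p)
        = real (m choose k) * ((real m - real k) * q - real k * (p + q))"
      by simp
    then show ?thesis
      unfolding pascal p_def[symmetric] q_def[symmetric] by (simp add: algebra_simps)
  qed
  have "(\<Sum>k\<le>r. ?A k + ?B k - ?C k) = 0"
    using sum_binomial_telescope[of m ?f r] summand by (simp add: j)
  then have sums: "(\<Sum>k\<le>r. ?C k) = (\<Sum>k\<le>r. ?A k) + (\<Sum>k\<le>r. ?B k)"
    by (simp only: sum.distrib sum_subtractf)
  have "partial_num r j * R_sum m r (j - 1) = ?c * (\<Sum>k\<le>r. ?C k)"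
    by (simp add: R_sum_atMost partial_num_def j flip: sum_distrib_left)
  also have "\<dots> = ?c * (\<Sum>k\<le>r. ?A k) + ?c * (\<Sum>k\<le>r. ?B k)"
    unfolding sums by (rule distrib_left)
  also have "?c * (\<Sum>k\<le>r. ?A k) = partial_den m r j * R_sum m r j"
    by (simp add: R_sum_atMost partial_den_def flip: sum_distrib_left)
  also have "?c * (\<Sum>k\<le>r. ?B k) = R_sum m r (j + 1)"
    by (rule R_sum_Suc[symmetric])
  finally show ?thesis .
qed

section \<open>Evaluation of the continued fraction\<close>

theorem theorem1p1:
  fixes r m :: nat
  assumes "r \<le> m"
  shows "let b = partial_num r; a = partial_den m r; R = R_sum m r;
             T = (\<lambda>j. kettenbruch b a j r)
         in kettenbruch_defined b a 1 r
          \<and> (real r + 1) * real (m choose (r + 1)) / real (binom_sum m r) = a 0 + T 1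
          \<and> (\<forall>j. 1 \<le> j \<and> j \<le> r \<longrightarrow>
                T j = R j / R (j - 1) \<and> R j / R (j - 1) > 0
              \<and> b j * R (j - 1) - a j * R j = R (j + 1))
          \<and> (real m - real r) * real (m choose r) - a 0 * R 0 = R 1"
proof -
  let ?b = "partial_num r" and ?a = "partial_den m r" and ?R = "R_sum m r"
  have rec: "?b i * ?R (i - 1) = ?a i * ?R i + ?R (i + 1)" if "1 \<le> i" "i \<le> r" for i
    using R_sum_recurrence that by blast
  have pos: "?R i > 0" if "i \<le> r" for i
    using that by (rule R_sum_pos)
  have nz: "?R i \<noteq> 0" if "i \<le> r" for i
    using pos[OF that] by simp
  have b: "?b i \<noteq> 0" if "1 \<le> i" "i \<le> r" for i
    using that by (simp add: partial_num_def)
  have tail: "kettenbruch ?b ?a j r = ?R j / ?R (j - 1)" if "1 \<le> j" "j \<le> r + 1" for j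
    using kettenbruch_eq_quotient[of r ?b ?R ?a j, OF rec nz b R_sum_beyond that] .
  have "kettenbruch_defined ?b ?a 1 r"
    using kettenbruch_defined_of_recurrence[of r ?b ?R ?a, OF rec nz b R_sum_beyond] .
  moreover have "(real r + 1) * real (m choose (r + 1)) / real (binom_sum m r)
      = ?a 0 + kettenbruch ?b ?a 1 r"
    unfolding R_sum_recurrence_0 R_sum_0[symmetric]
    using tail[of 1] nz[of 0] by (simp add: field_simps)
  moreover have "kettenbruch ?b ?a j r = ?R j / ?R (j - 1) \<and> ?R j / ?R (j - 1) > 0
      \<and> ?b j * ?R (j - 1) - ?a j * ?R j = ?R (j + 1)" if "1 \<le> j" "j \<le> r" for j
    using tail[of j] pos[of j] pos[of "j - 1"] rec[of j] that by simp
  moreover have "(real m - real r) * real (m choose r) - ?a 0 * ?R 0 = ?R 1"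
    using R_sum_recurrence_0[of r m] binomial_absorb_real[of r m] by simp
  ultimately show ?thesis
    unfolding Let_def by blast
qed

end
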